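(* Let $p$ be a prime and $k\in\mathbb{N}$. Let $G$ be a finite cyclic group equipped with a filtration $G_\bullet$ of degree exactly $k$ (i.e. $G_{k+1}=\{0\}\ne G_k$) such that the associated group nilspace is $p$-homogeneous. Then $G\cong\mathbb{Z}_{p^d}$ for some positive integer $d\le\lfloor\frac{k-1}{p-1}\rfloor+1$, and there is a $(p-1)$-separated set $\Delta\subset\{1,\dots,k\}$ with $|\Delta|=d$ and $k\in\Delta$, such that $G_{i+1}=p\cdot G_i$ for every $i\in\Delta$ and $G_{i+1}=G_i$ otherwise.
   Context: A set of integers is $t$-separated if every pair of (distinct) integers $a,b$ in the set satisfies $|a-b|\ge t$. A filtration on a group $G$ is a sequence of subgroups $G=G_0=G_1\ge G_2\ge\cdots$ with $[G_i,G_j]\subset G_{i+j}$. The associated group nilspace is the set $G$ with cube sets $C^n(G_\bullet)$, $n\ge0$, where $C^n(G_\bullet)$ is the subgroup of $G^{\{0,1\}^n}$ generated by the elements $g^F$, for $F$ a face of $\{0,1\}^n$ of codimension $i$ and $g\in G_i$, with $g^F(v)=g$ for $v\in F$ and $g^F(v)$ the identity otherwise. A morphism between nilspaces $X,Y$ (sets with cube sets $C^n(X)\subset X^{\{0,1\}^n}$, $C^n(Y)\subset Y^{\{0,1\}^n}$) is a map $f:X\to Y$ with $f\circ c\in C^n(Y)$ for all $n$ and $c\in C^n(X)$; $\hom(X,Y)$ is the set of morphisms. For an abelian group $A$, $\mathcal{D}_1(A)$ is the nilspace on $A$ whose $n$-cubes are the maps $v\mapsto x+v_1h_1+\dots+v_nh_n$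 with $x,h_i\in A$. A nilspace $X$ is $p$-homogeneous if for every $n\ge1$ and every $f\in\hom(\mathcal{D}_1(\mathbb{Z}^n),X)$, the restriction $f|_{[0,p-1]^n}$ is in $\hom(\mathcal{D}_1(\mathbb{Z}_p^n),X)$, where $[0,p-1]^n$ is identified with $\mathbb{Z}_p^n$ (addition mod $p$). *)

theory Defs
  imports
    "HOL-Computational_Algebra.Primes"
    "HOL-Algebra.FiniteProduct"
    "HOL-Algebra.Elementary_Groups"
    "HOL-Algebra.Product_Groups"
begin

definition separated :: "int \<Rightarrow> int set \<Rightarrow> bool" where
  "separated t S \<longleftrightarrow> (\<forall>a\<in>S. \<forall>b\<in>S. a \<noteq> b \<longrightarrow> \<bar>a - b\<bar> \<ge> t)"


text \<open>The discrete cube \<open>{0,1}\<^sup>n\<close>, with coordinates indexed by \<open>{..<n}\<close>.\<close>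

definition discrete_cube :: "nat \<Rightarrow> (nat \<Rightarrow> nat) set" where
  "discrete_cube n = ({..<n} \<rightarrow>\<^sub>E {0, 1})"

text \<open>A face of codimension \<open>i\<close> is obtained by prescribing exactly \<open>i\<close> of the \<open>n\<close> coordinates.\<close>

definition is_face :: "nat \<Rightarrow> nat \<Rightarrow> (nat \<Rightarrow> nat) set \<Rightarrow> bool" where
  "is_face n i F \<longleftrightarrow>
     (\<exists>I w. I \<subseteq> {..<n} \<and> card I = i \<and> w \<in> discrete_cube n \<and>
        F = {v \<in> discrete_cube n. \<forall>j\<in>I. v j = w j})"


text \<open>A set together with cube sets. No nilspace axioms are imposed, as morphisms and
  homogeneity only refer to this data. Cubes and morphisms are extensional functions, i.e.
  \<open>undefined\<close> outside their domain, so that they correspond exactly to maps between sets.\<close>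

record 'a cube_structure =
  points :: "'a set"
  cubes :: "nat \<Rightarrow> ((nat \<Rightarrow> nat) \<Rightarrow> 'a) set"

definition nil_hom :: "'a cube_structure \<Rightarrow> 'b cube_structure \<Rightarrow> ('a \<Rightarrow> 'b) set" where
  "nil_hom X Y =
     {f \<in> points X \<rightarrow>\<^sub>E points Y.
        \<forall>n. \<forall>c \<in> cubes X n. compose (discrete_cube n) f c \<in> cubes Y n}"

text \<open>The nilspace \<open>\<D>\<^sub>1(A)\<close> of an abelian group, written multiplicatively: its cubes are
  \<open>v \<mapsto> x + v\<^sub>1 h\<^sub>1 + \<dots> + v\<^sub>n h\<^sub>n\<close>.\<close>

definition D1 :: "('a, 'b) monoid_scheme \<Rightarrow> 'a cube_structure" where
  "D1 A =
     \<lparr>points = carrier A,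
      cubes = (\<lambda>n. {\<lambda>v\<in>discrete_cube n. x \<otimes>\<^bsub>A\<^esub> (\<Otimes>\<^bsub>A\<^esub>j\<in>{..<n}. h j [^]\<^bsub>A\<^esub> v j) | x h.
                    x \<in> carrier A \<and> h \<in> {..<n} \<rightarrow> carrier A})\<rparr>"

definition commutator_subgroup :: "('a, 'b) monoid_scheme \<Rightarrow> 'a set \<Rightarrow> 'a set \<Rightarrow> 'a set" where
  "commutator_subgroup G H K =
     generate G {g \<otimes>\<^bsub>G\<^esub> h \<otimes>\<^bsub>G\<^esub> inv\<^bsub>G\<^esub> g \<otimes>\<^bsub>G\<^esub> inv\<^bsub>G\<^esub> h | g h. g \<in> H \<and> h \<in> K}"

definition filtration :: "('a, 'b) monoid_scheme \<Rightarrow> (nat \<Rightarrow> 'a set) \<Rightarrow> bool" where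
  "filtration G Gs \<longleftrightarrow>
     (\<forall>i. subgroup (Gs i) G) \<and>
     Gs 0 = carrier G \<and> Gs 1 = carrier G \<and>
     (\<forall>i. Gs (Suc i) \<subseteq> Gs i) \<and>
     (\<forall>i j. commutator_subgroup G (Gs i) (Gs j) \<subseteq> Gs (i + j))"

definition filtration_degree :: "('a, 'b) monoid_scheme \<Rightarrow> (nat \<Rightarrow> 'a set) \<Rightarrow> nat \<Rightarrow> bool" where
  "filtration_degree G Gs k \<longleftrightarrow> Gs (Suc k) = {\<one>\<^bsub>G\<^esub>} \<and> Gs k \<noteq> {\<one>\<^bsub>G\<^esub>}"

text \<open>The element \<open>g\<^sup>F\<close> of \<open>G\<close> to the power \<open>{0,1}\<^sup>n\<close>.\<close>

definition face_elem ::
    "('a, 'b) monoid_scheme \<Rightarrow> nat \<Rightarrow> 'a \<Rightarrow> (nat \<Rightarrow> nat) set \<Rightarrow> ((nat \<Rightarrow> nat) \<Rightarrow> 'a)" where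
  "face_elem G n g F = (\<lambda>v\<in>discrete_cube n. if v \<in> F then g else \<one>\<^bsub>G\<^esub>)"

definition group_nilspace ::
    "('a, 'b) monoid_scheme \<Rightarrow> (nat \<Rightarrow> 'a set) \<Rightarrow> 'a cube_structure" where
  "group_nilspace G Gs =
     \<lparr>points = carrier G,
      cubes = (\<lambda>n. generate (product_group (discrete_cube n) (\<lambda>_. G))
                    {face_elem G n g F | g F. \<exists>i. is_face n i F \<and> g \<in> Gs i})\<rparr>"

text \<open>The carrier of \<open>product_group {..<n} (\<lambda>_. integer_mod_group p)\<close> is, for \<open>p > 0\<close>, literally
  the box \<open>[0, p - 1]\<^sup>n\<close> inside \<open>\<int>\<^sup>n\<close>, with addition mod \<open>p\<close>; hence the identification of the
  box with \<open>\<int>\<^sub>p\<^sup>n\<close> needs no explicit map.\<close>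

definition p_homogeneous :: "nat \<Rightarrow> 'a cube_structure \<Rightarrow> bool" where
  "p_homogeneous p X \<longleftrightarrow>
     (\<forall>n::nat. n \<ge> 1 \<longrightarrow>
       (\<forall>f \<in> nil_hom (D1 (product_group {..<n} (\<lambda>_. integer_group))) X.
        restrict f ({..<n} \<rightarrow>\<^sub>E {0..int p - 1})
          \<in> nil_hom (D1 (product_group {..<n} (\<lambda>_. integer_mod_group p))) X))"

end

theory Submission
  imports Defs "HOL-Algebra.Multiplicative_Group"
begin

text \<open>Everything follows from one consequence of homogeneity: in an abelian group, if
  \<open>i \<ge> 1\<close> and \<open>g \<in> G\<^sub>i\<close>, then \<open>g\<^sup>p \<in> G\<^bsub>i+p-1\<^esub>\<close> (lemma \<open>homogeneous_pow_in_filtration\<close>).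

  To see this, take the map \<open>x \<mapsto> g\<close> to the power \<open>x\<^sub>1 \<cdots> x\<^sub>i\<close> on \<open>\<int>\<^sup>i\<close>. It is a morphism, because
  along a cube every coordinate is an affine form in the vertex \<open>v\<close>, and a product of \<open>i\<close> affine
  forms expands into monomials of degree at most \<open>i\<close>, which on \<open>{0,1}\<^sup>n\<close> are indicators of faces of
  codimension at most \<open>i\<close> (lemma \<open>monomial_times_affine_forms_in_group_cubes\<close>). By homogeneity its
  restriction to the box sends cubes of \<open>\<int>\<^sub>p\<^sup>i\<close> to cubes. Consider the cube of dimension \<open>i + p - 1\<close>
  that uses one cube coordinate for each of \<open>i - 1\<close> of the variables and puts the sum of the
  remaining \<open>p\<close> into the last one. That sum wraps around modulo \<open>p\<close> only at the vertex where it
  equals \<open>p\<close>, so the exponent of \<open>g\<close> is a polynomial of degree at most \<open>i\<close> minus \<open>p\<close> times the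
  top monomial. The alternating product over the vertices of a cube of dimension \<open>n\<close> always lies in
  \<open>G\<^sub>n\<close> (lemma \<open>alternating_product_in_filtration\<close>). It kills the first part, whose degree is
  less than \<open>n\<close>, and leaves \<open>g\<close> to the power \<open>\<plusminus>p\<close>.

  Now let \<open>G\<close> be finite and cyclic and let \<open>\<Delta>\<close> be the set of jumps, \<open>G\<^bsub>i+1\<^esub> \<noteq> G\<^sub>i\<close>. At a jump,
  \<open>G\<^bsub>i+1\<^esub>\<close> is a proper subgroup of the cyclic group \<open>G\<^sub>i\<close> containing all its \<open>p\<close>-th powers, so it
  consists of these powers and has index \<open>p\<close>. Multiplying the indices gives
  \<open>|G| = p\<close> to the power \<open>|\<Delta>|\<close>. After a jump at \<open>i\<close> the filtration stays constant up to
  \<open>G\<^bsub>i+p-1\<^esub>\<close>, as this subgroup still contains the \<open>p\<close>-th powers; this separates the jumps and hence bounds their number.\<close>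

section \<open>The cubes of the group nilspace\<close>

lemma finite_discrete_cube [simp]: "finite (discrete_cube n)"
  by (auto simp: discrete_cube_def intro: finite_PiE)

lemma filtration_subgroup: "filtration G Gs \<Longrightarrow> subgroup (Gs i) G"
  by (simp add: filtration_def)

lemma filtration_antimono:
  assumes "filtration G Gs" "i \<le> j"
  shows "Gs j \<subseteq> Gs i"
  using lift_Suc_antimono_le[of Gs i j] assms by (auto simp: filtration_def)

lemma filtration_carrier: "filtration G Gs \<Longrightarrow> g \<in> Gs i \<Longrightarrow> g \<in> carrier G"
  by (meson filtration_subgroup subgroup.mem_carrier)

lemma (in group) subgroup_group_cubes:
  assumes "filtration G Gs"
  shows "subgroup (cubes (group_nilspace G Gs) n) (product_group (discrete_cube n) (\<lambda>_. G))"
  unfolding group_nilspace_def cube_structure.simps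
  by (rule group.generate_is_subgroup)
    (use filtration_carrier[OF assms] in \<open>auto simp: face_elem_def\<close>)

lemma (in group) face_elem_in_group_cubes:
  assumes "is_face n i F" "g \<in> Gs i"
  shows "face_elem G n g F \<in> cubes (group_nilspace G Gs) n"
  using assms by (auto simp: group_nilspace_def intro!: generate.incl)

lemma (in group) mult_in_group_cubes:
  assumes "filtration G Gs"
    and "restrict c (discrete_cube n) \<in> cubes (group_nilspace G Gs) n"
    and "restrict c' (discrete_cube n) \<in> cubes (group_nilspace G Gs) n"
  shows "(\<lambda>v\<in>discrete_cube n. c v \<otimes> c' v) \<in> cubes (group_nilspace G Gs) n"
  using subgroup.m_closed[OF subgroup_group_cubes[OF assms(1)] assms(2,3)]
  by (simp add: restrict_def cong: if_cong)

section \<open>Products of affine forms give morphisms\<close>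

lemma (in group) monomial_in_group_cubes:
  assumes "S \<subseteq> {..<n}" "g \<in> Gs (card S)" "g \<in> carrier G"
  shows "(\<lambda>v\<in>discrete_cube n. g [^] (of_bool (\<forall>j\<in>S. v j = 1) :: int))
           \<in> cubes (group_nilspace G Gs) n"
proof -
  let ?w = "\<lambda>j\<in>{..<n}. 1 :: nat"
  let ?F = "{v \<in> discrete_cube n. \<forall>j\<in>S. v j = ?w j}"
  have "is_face n (card S) ?F"
    unfolding is_face_def using assms(1)
    by (intro exI[of _ S] exI[of _ ?w]) (auto simp: discrete_cube_def)
  from face_elem_in_group_cubes[of n "card S" ?F g Gs, OF this assms(2)]
  have "face_elem G n g ?F \<in> cubes (group_nilspace G Gs) n" .
  also have "face_elem G n g ?F
      = (\<lambda>v\<in>discrete_cube n. g [^] (of_bool (\<forall>j\<in>S. v j = 1) :: int))"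
    unfolding face_elem_def using assms by (intro restrict_ext) (auto simp: subset_iff)
  finally show ?thesis .
qed

text \<open>The face indicator is carried along because the induction multiplies the affine forms out one
  at a time. A constant term leaves the monomial alone; a linear term in \<open>v j\<close> adds \<open>j\<close> to \<open>S\<close>,
  as \<open>v j\<close> is idempotent on the cube, and so raises the codimension by at most one. The index
  \<open>m + card S\<close> is the largest codimension that can arise.\<close>

lemma (in comm_group) monomial_times_affine_forms_in_group_cubes:
  fixes x :: "nat \<Rightarrow> int" and h :: "nat \<Rightarrow> nat \<Rightarrow> int"
  assumes filt: "filtration G Gs"
    and "S \<subseteq> {..<n}" and "g \<in> Gs (m + card S)"
  shows "(\<lambda>v\<in>discrete_cube n.
            g [^] (of_bool (\<forall>j\<in>S. v j = 1) * (\<Prod>l<m. x l + (\<Sum>j<n. int (v j) * h j l))))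
           \<in> cubes (group_nilspace G Gs) n"
  using assms(2,3)
proof (induction m arbitrary: S g)
  case 0
  then show ?case
    using monomial_in_group_cubes[of S n g Gs] filtration_carrier[OF filt]
    by (simp only: lessThan_0 prod.empty mult_1_right add_0)
next
  case (Suc m)
  note IH = Suc.IH
  have g: "g \<in> carrier G"
    using Suc.prems filtration_carrier[OF filt] by blast
  define P where "P v = (\<Prod>l<m. x l + (\<Sum>j<n. int (v j) * h j l))" for v
  have pow: "g [^] (a :: int) \<in> Gs j" if "j \<le> Suc (m + card S)" for a j
  proof -
    have "g \<in> Gs j"
      using Suc.prems filtration_antimono[OF filt that] by auto
    then show ?thesis
      by (rule subgroup_int_pow_closed[OF filtration_subgroup[OF filt]])
  qed
  \<comment> \<open>The terms of the last form are added one at a time; each is an instance of the outer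
      induction hypothesis, with \<open>x m\<close> or \<open>h M m\<close> absorbed into \<open>g\<close>.\<close>
  have "(\<lambda>v\<in>discrete_cube n.
          g [^] (of_bool (\<forall>j\<in>S. v j = 1) * P v * (x m + (\<Sum>j<M. int (v j) * h j m))))
         \<in> cubes (group_nilspace G Gs) n" if "M \<le> n" for M
    using that
  proof (induction M)
    case 0
    have "(\<lambda>v\<in>discrete_cube n. (g [^] x m) [^] (of_bool (\<forall>j\<in>S. v j = 1) * P v))
         \<in> cubes (group_nilspace G Gs) n"
      unfolding P_def by (rule IH[OF Suc.prems(1)]) (rule pow, simp)
    then show ?case
      using g by (simp add: int_pow_pow mult_ac del: restrict_apply)
  next
    case (Suc M)
    have "card (insert M S) \<le> Suc (card S)"
      by (rule card_insert_le_m1) auto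
    then have 2: "(\<lambda>v\<in>discrete_cube n.
          (g [^] h M m) [^] (of_bool (\<forall>j\<in>insert M S. v j = 1) * P v))
         \<in> cubes (group_nilspace G Gs) n"
      unfolding P_def using Suc.prems \<open>S \<subseteq> {..<n}\<close>
      by (intro IH pow) auto
    have 1: "(\<lambda>v\<in>discrete_cube n.
          g [^] (of_bool (\<forall>j\<in>S. v j = 1) * P v * (x m + (\<Sum>j<M. int (v j) * h j m))))
         \<in> cubes (group_nilspace G Gs) n"
      by (rule Suc.IH) (use Suc.prems in simp)
    have eq: "g [^] (of_bool (\<forall>j\<in>S. v j = 1) * P v * (x m + (\<Sum>j<M. int (v j) * h j m)))
              \<otimes> (g [^] h M m) [^] (of_bool (\<forall>j\<in>insert M S. v j = 1) * P v)
            = g [^] (of_bool (\<forall>j\<in>S. v j = 1) * P v * (x m + (\<Sum>j<Suc M. int (v j) * h j m)))"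
      if "v \<in> discrete_cube n" for v
    proof -
      have "v M = 0 \<or> v M = 1"
        using that Suc.prems by (auto simp: discrete_cube_def PiE_iff)
      then have "of_bool (\<forall>j\<in>insert M S. v j = 1) = of_bool (\<forall>j\<in>S. v j = 1) * int (v M)"
        by auto
      then show ?thesis
        using g by (simp add: int_pow_pow int_pow_mult[symmetric] algebra_simps del: of_bool_eq_iff)
    qed
    note mult_in_group_cubes[OF filt 1 2]
    also note restrict_ext[OF eq]
    finally show ?case .
  qed
  from this[of n] show ?case
    by (simp add: P_def mult.assoc del: restrict_apply)
qed

lemma comm_group_product_group:
  assumes "\<And>i. i \<in> I \<Longrightarrow> comm_group (G i)"
  shows "comm_group (product_group I G)"
proof (rule group.group_comm_groupI)
  show "group (product_group I G)"
    using assms by (simp add: comm_group.axioms(2))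
  fix x y assume "x \<in> carrier (product_group I G)" "y \<in> carrier (product_group I G)"
  then show "x \<otimes>\<^bsub>product_group I G\<^esub> y = y \<otimes>\<^bsub>product_group I G\<^esub> x"
    using assms by (auto simp: PiE_iff intro!: restrict_ext comm_monoid.m_comm comm_group.axioms(1))
qed

text \<open>Since \<open>integer_mod_group 0\<close> is \<open>\<int>\<close> and \<open>a mod 0 = a\<close>, the next two lemmas describe the cubes
  of \<open>\<int>\<^sup>L\<close> and of \<open>\<int>\<^sub>q\<^sup>L\<close> at once.\<close>

lemma D1_integer_mod_cube_eq:
  fixes q :: nat and L :: "'a set"
  defines "P \<equiv> product_group L (\<lambda>_. integer_mod_group q)"
  assumes x: "x \<in> carrier P" and h: "h \<in> A \<rightarrow> carrier P" and "finite A"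
  shows "x \<otimes>\<^bsub>P\<^esub> (\<Otimes>\<^bsub>P\<^esub>j\<in>A. h j [^]\<^bsub>P\<^esub> v j)
           = (\<lambda>l\<in>L. (x l + (\<Sum>j\<in>A. int (v j) * h j l)) mod int q)"
proof -
  interpret P: comm_group P
    unfolding P_def by (rule comm_group_product_group) simp
  have pow: "(y [^]\<^bsub>P\<^esub> (m :: nat)) l = int m * y l mod int q" if "l \<in> L" for y m l
    by (induction m) (use that in \<open>auto simp: P_def algebra_simps mod_simps\<close>)
  have "(\<Otimes>\<^bsub>P\<^esub>j\<in>A. h j [^]\<^bsub>P\<^esub> v j) l = (\<Sum>j\<in>A. int (v j) * h j l) mod int q" if l: "l \<in> L" for l
    using \<open>finite A\<close> h
  proof (induction A)
    case empty
    show ?case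
      unfolding P.finprod_empty using l by (simp add: P_def)
  next
    case (insert a A)
    have "(\<Otimes>\<^bsub>P\<^esub>j\<in>insert a A. h j [^]\<^bsub>P\<^esub> v j)
        = h a [^]\<^bsub>P\<^esub> v a \<otimes>\<^bsub>P\<^esub> (\<Otimes>\<^bsub>P\<^esub>j\<in>A. h j [^]\<^bsub>P\<^esub> v j)"
      using insert.hyps insert.prems by (intro P.finprod_insert) auto
    moreover have "(y \<otimes>\<^bsub>P\<^esub> z) l = (y l + z l) mod int q" for y z
      using l by (simp add: P_def)
    ultimately show ?case
      using insert pow[OF l] by (simp add: mod_simps)
  qed
  then show ?thesis
    by (auto simp: P_def mod_simps)
qed

lemma D1_integer_mod_cubes:
  "cubes (D1 (product_group L (\<lambda>_. integer_mod_group q))) n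
     = {\<lambda>v\<in>discrete_cube n. \<lambda>l\<in>L. (x l + (\<Sum>j<n. int (v j) * h j l)) mod int q | x h.
          x \<in> L \<rightarrow>\<^sub>E carrier (integer_mod_group q)
          \<and> h \<in> {..<n} \<rightarrow> (L \<rightarrow>\<^sub>E carrier (integer_mod_group q))}"
proof -
  let ?P = "product_group L (\<lambda>_. integer_mod_group q)"
  have eq: "(\<lambda>v\<in>discrete_cube n. x \<otimes>\<^bsub>?P\<^esub> (\<Otimes>\<^bsub>?P\<^esub>j\<in>{..<n}. h j [^]\<^bsub>?P\<^esub> v j))
      = (\<lambda>v\<in>discrete_cube n. \<lambda>l\<in>L. (x l + (\<Sum>j<n. int (v j) * h j l)) mod int q)"
    if "x \<in> carrier ?P" "h \<in> {..<n} \<rightarrow> carrier ?P" for x h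
    by (intro restrict_ext D1_integer_mod_cube_eq that) simp
  show ?thesis
    unfolding D1_def cube_structure.simps carrier_product_group[symmetric]
    by (simp only: eq cong: rev_conj_cong)
qed

lemma (in comm_group) monomial_nil_hom:
  assumes filt: "filtration G Gs" and g: "g \<in> Gs i"
  shows "(\<lambda>x\<in>{..<i} \<rightarrow>\<^sub>E UNIV. g [^] (\<Prod>l<i. x l :: int))
           \<in> nil_hom (D1 (product_group {..<i} (\<lambda>_. integer_group))) (group_nilspace G Gs)"
proof -
  have Z: "integer_group = integer_mod_group 0"
    by (simp add: integer_mod_group_def)
  let ?P = "product_group {..<i} (\<lambda>_. integer_mod_group 0)"
  let ?f = "\<lambda>x\<in>{..<i} \<rightarrow>\<^sub>E UNIV. g [^] (\<Prod>l<i. x l :: int)"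
  have gc: "g \<in> carrier G"
    by (rule filtration_carrier[OF filt g])
  have "compose (discrete_cube n) ?f c \<in> cubes (group_nilspace G Gs) n"
    if c_cube: "c \<in> cubes (D1 ?P) n" for n c
  proof -
    obtain x :: "nat \<Rightarrow> int" and h :: "nat \<Rightarrow> nat \<Rightarrow> int"
      where c: "c = (\<lambda>v\<in>discrete_cube n. \<lambda>l\<in>{..<i}. x l + (\<Sum>j<n. int (v j) * h j l))"
      using c_cube unfolding D1_integer_mod_cubes mem_Collect_eq of_nat_0 mod_by_0 by blast
    have "compose (discrete_cube n) ?f c
        = (\<lambda>v\<in>discrete_cube n. g [^] (\<Prod>l<i. x l + (\<Sum>j<n. int (v j) * h j l)))"
      unfolding compose_def c by (rule restrict_ext) simp
    also have "\<dots> \<in> cubes (group_nilspace G Gs) n"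
      using monomial_times_affine_forms_in_group_cubes[OF filt, of "{}" n g i x h] g
      by (simp del: restrict_apply)
    finally show ?thesis .
  qed
  moreover have "?f \<in> points (D1 ?P) \<rightarrow>\<^sub>E points (group_nilspace G Gs)"
    using gc by (auto simp: D1_def group_nilspace_def carrier_integer_mod_group)
  ultimately show ?thesis
    unfolding Z nil_hom_def by (intro CollectI conjI allI ballI)
qed

section \<open>Alternating products over cubes\<close>

lemma (in comm_group) finprod_int_pow:
  assumes "g \<in> carrier G" "finite A"
  shows "(\<Otimes>v\<in>A. g [^] (a v :: int)) = g [^] (\<Sum>v\<in>A. a v)"
  using assms(2) by induction (use assms(1) in \<open>auto simp: int_pow_mult\<close>)

definition vertex_sign :: "nat \<Rightarrow> (nat \<Rightarrow> nat) \<Rightarrow> int" where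
  "vertex_sign n v = (\<Prod>j<n. (-1) ^ v j)"

lemma sum_discrete_cube_prod:
  "(\<Sum>v\<in>discrete_cube n. \<Prod>j<n. f j (v j)) = (\<Prod>j<n. f j 0 + f j 1 :: int)"
proof -
  have "(\<Prod>j<n. \<Sum>y\<in>{0, 1}. f j y) = (\<Sum>v\<in>discrete_cube n. \<Prod>j<n. f j (v j))"
    unfolding discrete_cube_def by (rule prod_sum_PiE) auto
  then show ?thesis by simp
qed

text \<open>The signed sum over a face factors over the coordinates, and a free coordinate contributes
  \<open>1 - 1\<close>. Equivalently, the alternating sum kills every monomial other than the top one.\<close>

lemma sum_vertex_sign_face:
  assumes "I \<subset> {..<n}"
  shows "(\<Sum>v\<in>discrete_cube n. of_bool (\<forall>j\<in>I. v j = w j) * vertex_sign n v) = 0"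
proof -
  obtain j0 where j0: "j0 < n" "j0 \<notin> I"
    using assms by auto
  have "of_bool (\<forall>j\<in>I. v j = w j) = (\<Prod>j<n. of_bool (j \<in> I \<longrightarrow> v j = w j) :: int)" for v
  proof (cases "\<forall>j\<in>I. v j = w j")
    case False
    then obtain j where "j \<in> I" "v j \<noteq> w j" by blast
    moreover from this have "j < n" using assms by auto
    ultimately have "(\<Prod>j<n. of_bool (j \<in> I \<longrightarrow> v j = w j) :: int) = 0"
      by (intro prod_zero) auto
    then show ?thesis using False by simp
  qed auto
  then have "(\<Sum>v\<in>discrete_cube n. of_bool (\<forall>j\<in>I. v j = w j) * vertex_sign n v)
      = (\<Sum>v\<in>discrete_cube n. \<Prod>j<n. of_bool (j \<in> I \<longrightarrow> v j = w j) * (-1) ^ v j)"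
    by (simp only: vertex_sign_def prod.distrib)
  also have "\<dots> = (\<Prod>j<n. of_bool (j \<in> I \<longrightarrow> 0 = w j) * (-1) ^ 0
                       + of_bool (j \<in> I \<longrightarrow> 1 = w j) * (-1) ^ (1 :: nat))"
    by (rule sum_discrete_cube_prod[where f = "\<lambda>j y. of_bool (j \<in> I \<longrightarrow> y = w j) * (-1) ^ y"])
  also have "\<dots> = 0"
    by (rule prod_zero) (use j0 in auto)
  finally show ?thesis .
qed

text \<open>The alternating product is a homomorphism, so it is enough to look at the generators. On
  \<open>g\<^sup>F\<close> it is trivial unless \<open>F\<close> is a single vertex, which has codimension \<open>n\<close> and forces
  \<open>g \<in> G\<^sub>n\<close>.\<close>

lemma (in comm_group) alternating_product_in_filtration:
  assumes filt: "filtration G Gs" and c: "c \<in> cubes (group_nilspace G Gs) n"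
  shows "(\<Otimes>v\<in>discrete_cube n. c v [^] vertex_sign n v) \<in> Gs n"
proof -
  let ?P = "product_group (discrete_cube n) (\<lambda>_. G)"
  interpret P: group ?P
    by simp
  interpret Gn: subgroup "Gs n" G
    using filt by (rule filtration_subgroup)
  let ?alt = "\<lambda>c. \<Otimes>v\<in>discrete_cube n. c v [^] vertex_sign n v"
  let ?K = "{c \<in> carrier ?P. ?alt c \<in> Gs n}"
  have hom: "group_hom ?P G ?alt"
  proof (intro group_hom.intro group_hom_axioms.intro homI)
    fix c c' assume cc: "c \<in> carrier ?P" "c' \<in> carrier ?P"
    have "?alt (c \<otimes>\<^bsub>?P\<^esub> c')
        = (\<Otimes>v\<in>discrete_cube n. c v [^] vertex_sign n v \<otimes> c' v [^] vertex_sign n v)"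
      using cc by (intro finprod_cong') (auto simp: int_pow_distrib PiE_iff)
    also have "\<dots> = ?alt c \<otimes> ?alt c'"
      using cc by (intro finprod_multf) (auto simp: PiE_iff)
    finally show "?alt (c \<otimes>\<^bsub>?P\<^esub> c') = ?alt c \<otimes> ?alt c'" .
  qed (auto simp: PiE_iff)
  interpret alt: group_hom ?P G ?alt
    by (rule hom)
  have K: "subgroup ?K ?P"
    by (rule P.subgroupI)
      (use alt.hom_one alt.hom_mult alt.hom_inv P.m_closed P.inv_closed P.one_closed in
        \<open>auto simp del: one_product_group mult_product_group inv_product_group carrier_product_group\<close>)
  have "face_elem G n g F \<in> ?K" if F: "is_face n i F" and g: "g \<in> Gs i" for g F i
  proof -
    obtain I w where I: "I \<subseteq> {..<n}" "card I = i"
      and F: "F = {v \<in> discrete_cube n. \<forall>j\<in>I. v j = w j}"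
      using F unfolding is_face_def by blast
    have gc: "g \<in> carrier G"
      by (rule filtration_carrier[OF filt g])
    have "?alt (face_elem G n g F)
        = (\<Otimes>v\<in>discrete_cube n. g [^] (of_bool (\<forall>j\<in>I. v j = w j) * vertex_sign n v))"
      by (intro finprod_cong') (use gc in \<open>auto simp: face_elem_def F\<close>)
    also have "\<dots> = g [^] (\<Sum>v\<in>discrete_cube n. of_bool (\<forall>j\<in>I. v j = w j) * vertex_sign n v)"
      by (rule finprod_int_pow[OF gc]) simp
    also have "\<dots> \<in> Gs n"
    proof (cases "I = {..<n}")
      case True
      then have "g \<in> Gs n" using g I by simp
      then show ?thesis
        by (rule subgroup_int_pow_closed[OF Gn.subgroup_axioms])
    next
      case False
      then have "I \<subset> {..<n}" using I by auto
      then show ?thesis unfolding sum_vertex_sign_face[OF \<open>I \<subset> {..<n}\<close>] by simp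
    qed
    finally show ?thesis
      using gc by (auto simp: face_elem_def)
  qed
  then have "generate ?P {face_elem G n g F | g F. \<exists>i. is_face n i F \<and> g \<in> Gs i} \<subseteq> ?K"
    by (intro P.generate_subgroup_incl[OF _ K]) blast
  then show ?thesis
    using c by (auto simp: group_nilspace_def)
qed

section \<open>Homogeneity pushes the powers down the filtration\<close>

text \<open>Reduction modulo \<open>card J\<close> has an effect only at the vertex with all coordinates \<open>1\<close>.\<close>

lemma sum_mod_on_cube:
  assumes "finite J" "\<And>j. j \<in> J \<Longrightarrow> v j \<in> {0, 1 :: nat}"
  shows "(\<Sum>j\<in>J. int (v j)) mod int (card J) = (\<Sum>j\<in>J. int (v j)) - int (card J) * (\<Prod>j\<in>J. int (v j))"
proof (cases "\<forall>j\<in>J. v j = 1")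
  case True
  then show ?thesis by simp
next
  case False
  then obtain j where j: "j \<in> J" "v j = 0"
    using assms(2) by fastforce
  have "(\<Sum>j\<in>J. int (v j)) < (\<Sum>j\<in>J. 1)"
    by (rule sum_strict_mono_ex1) (use assms j in \<open>force+\<close>)
  moreover have "(\<Prod>j\<in>J. int (v j)) = 0"
    using assms j by (intro prod_zero) auto
  ultimately show ?thesis
    by (simp add: sum_nonneg)
qed

text \<open>Without the reduction modulo \<open>p\<close> the polynomial has degree \<open>m + 1 < m + p\<close> and its signed sum
  vanishes. What remains is the correction at the top monomial.\<close>

lemma sum_vertex_sign_wrapped:
  assumes "p \<ge> 2"
  shows "(\<Sum>v\<in>discrete_cube (m + p). (\<Prod>l<m. int (v l)) * ((\<Sum>j\<in>{m..<m + p}. int (v j)) mod int p)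
            * vertex_sign (m + p) v)
         = - int p * (-1) ^ (m + p)"
proof -
  let ?n = "m + p"
  let ?C = "discrete_cube ?n"
  have split: "{..<?n} = {..<m} \<union> {m..<?n}" by auto
  have full: "(\<Sum>v\<in>?C. (\<Prod>j<?n. int (v j)) * vertex_sign ?n v) = (-1) ^ ?n"
    using sum_discrete_cube_prod[where n = ?n and f = "\<lambda>_ y. int y * (-1) ^ y"]
    by (simp add: vertex_sign_def prod.distrib)
  have partial: "(\<Sum>v\<in>?C. (\<Prod>l<m. int (v l)) * int (v j) * vertex_sign ?n v) = 0"
    if j: "j \<in> {m..<?n}" for j
  proof -
    let ?S = "insert j {..<m}"
    have "?S \<noteq> {..<?n}"
    proof
      assume "?S = {..<?n}"
      then have "card ?S = ?n" by simp
      then show False using assms j by simp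
    qed
    then have S: "?S \<subset> {..<?n}"
      using j by (intro psubsetI) auto
    have "(\<Prod>l<m. int (v l)) * int (v j) = of_bool (\<forall>l\<in>?S. v l = 1)" if "v \<in> ?C" for v
    proof -
      have v01: "v l = 0 \<or> v l = 1" if "l < ?n" for l
        using \<open>v \<in> ?C\<close> that by (auto simp: discrete_cube_def PiE_iff)
      have "(\<Prod>l<m. int (v l)) * int (v j) = (\<Prod>l\<in>?S. int (v l))"
        using j by simp
      also have "\<dots> = of_bool (\<forall>l\<in>?S. v l = 1)"
      proof (cases "\<forall>l\<in>?S. v l = 1")
        case False
        then obtain l where "l \<in> ?S" "v l = 0"
          using v01 S by blast
        then have 0: "(\<Prod>l\<in>?S. int (v l)) = 0"
          by (intro prod_zero) auto
        show ?thesis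
          unfolding 0 using False by simp
      next
        case True
        then have 1: "(\<Prod>l\<in>?S. int (v l)) = 1"
          by (intro prod.neutral) auto
        show ?thesis
          unfolding 1 using True by simp
      qed
      finally show ?thesis .
    qed
    then have "(\<Sum>v\<in>?C. (\<Prod>l<m. int (v l)) * int (v j) * vertex_sign ?n v)
        = (\<Sum>v\<in>?C. of_bool (\<forall>l\<in>?S. v l = 1) * vertex_sign ?n v)"
      by (intro sum.cong) auto
    also have "\<dots> = 0"
      using sum_vertex_sign_face[OF S, of "\<lambda>_. 1"] by simp
    finally show ?thesis .
  qed
  have "(\<Prod>l<m. int (v l)) * ((\<Sum>j\<in>{m..<?n}. int (v j)) mod int p) * vertex_sign ?n v
      = (\<Sum>j\<in>{m..<?n}. (\<Prod>l<m. int (v l)) * int (v j) * vertex_sign ?n v)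
        - int p * ((\<Prod>j<?n. int (v j)) * vertex_sign ?n v)" if v: "v \<in> ?C" for v
  proof -
    have wrap: "(\<Sum>j\<in>{m..<?n}. int (v j)) mod int p
        = (\<Sum>j\<in>{m..<?n}. int (v j)) - int p * (\<Prod>j\<in>{m..<?n}. int (v j))"
      using sum_mod_on_cube[of "{m..<?n}" v] v by (auto simp: discrete_cube_def PiE_iff)
    have all: "(\<Prod>j<?n. int (v j)) = (\<Prod>l<m. int (v l)) * (\<Prod>j\<in>{m..<?n}. int (v j))"
      unfolding split by (rule prod.union_disjoint) auto
    have pull: "(\<Sum>j\<in>{m..<?n}. (\<Prod>l<m. int (v l)) * int (v j) * vertex_sign ?n v)
        = (\<Prod>l<m. int (v l)) * (\<Sum>j\<in>{m..<?n}. int (v j)) * vertex_sign ?n v"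
      by (simp only: sum_distrib_left sum_distrib_right)
    show ?thesis
      unfolding wrap all pull by (simp only: algebra_simps)
  qed
  then have "(\<Sum>v\<in>?C. (\<Prod>l<m. int (v l)) * ((\<Sum>j\<in>{m..<?n}. int (v j)) mod int p) * vertex_sign ?n v)
      = (\<Sum>v\<in>?C. \<Sum>j\<in>{m..<?n}. (\<Prod>l<m. int (v l)) * int (v j) * vertex_sign ?n v)
        - int p * (\<Sum>v\<in>?C. (\<Prod>j<?n. int (v j)) * vertex_sign ?n v)"
    by (simp only: sum_subtractf sum_distrib_left cong: sum.cong)
  also have "(\<Sum>v\<in>?C. \<Sum>j\<in>{m..<?n}. (\<Prod>l<m. int (v l)) * int (v j) * vertex_sign ?n v)
      = (\<Sum>j\<in>{m..<?n}. \<Sum>v\<in>?C. (\<Prod>l<m. int (v l)) * int (v j) * vertex_sign ?n v)"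
    by (rule sum.swap)
  also have "\<dots> = 0"
    using partial by (intro sum.neutral) blast
  also have "0 - int p * (\<Sum>v\<in>?C. (\<Prod>j<?n. int (v j)) * vertex_sign ?n v) = - int p * (-1) ^ ?n"
    unfolding full by simp
  finally show ?thesis .
qed

lemma (in comm_group) homogeneous_pow_in_filtration:
  assumes filt: "filtration G Gs" and homog: "p_homogeneous p (group_nilspace G Gs)"
    and p: "p \<ge> 2" and g: "g \<in> Gs (Suc m)"
  shows "g [^] p \<in> Gs (m + p)"
proof -
  let ?i = "Suc m" and ?n = "m + p"
  let ?P = "product_group {..<?i} (\<lambda>_. integer_mod_group p)"
  let ?B = "{..<?i} \<rightarrow>\<^sub>E {0..int p - 1}"
  let ?f = "\<lambda>x\<in>{..<?i} \<rightarrow>\<^sub>E UNIV. g [^] (\<Prod>l<?i. x l :: int)"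
  have gc: "g \<in> carrier G"
    by (rule filtration_carrier[OF filt g])
  have carr: "carrier (integer_mod_group p) = {0..int p - 1}"
    using p by (auto simp: carrier_integer_mod_group)
  have hom: "restrict ?f ?B \<in> nil_hom (D1 ?P) (group_nilspace G Gs)"
    by (rule homog[unfolded p_homogeneous_def, rule_format, OF _ monomial_nil_hom[OF filt g]]) simp
  define x where "x = (\<lambda>l\<in>{..<?i}. 0 :: int)"
  \<comment> \<open>Direction \<open>j\<close> moves variable \<open>j\<close> for \<open>j < m\<close>; the last \<open>p\<close> directions all move variable \<open>m\<close>.\<close>
  define h where "h j = (\<lambda>l\<in>{..<?i}. of_bool (l = min j m) :: int)" for j
  define c where "c v = (\<lambda>l\<in>{..<?i}. (x l + (\<Sum>j<?n. int (v j) * h j l)) mod int p)" for v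
  have "restrict c (discrete_cube ?n) \<in> cubes (D1 ?P) ?n"
    unfolding D1_integer_mod_cubes c_def carr
    by (intro CollectI exI[of _ x] exI[of _ h] conjI refl) (use p in \<open>auto simp: x_def h_def\<close>)
  then have cube: "compose (discrete_cube ?n) (restrict ?f ?B) (restrict c (discrete_cube ?n))
      \<in> cubes (group_nilspace G Gs) ?n"
    using hom unfolding nil_hom_def by blast
  have mem: "c v \<in> ?B" for v
    using p by (auto simp: c_def)
  have prod: "(\<Prod>l<?i. c v l) = (\<Prod>l<m. int (v l)) * ((\<Sum>j\<in>{m..<?n}. int (v j)) mod int p)"
    if v: "v \<in> discrete_cube ?n" for v
  proof -
    have coord: "c v l = (\<Sum>j<?n. int (v j) * of_bool (l = min j m)) mod int p" if "l < ?i" for l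
      using that by (simp add: c_def x_def h_def)
    have "c v l = int (v l)" if l: "l < m" for l
    proof -
      have "v l \<in> {0, 1}"
        using v l by (auto simp: discrete_cube_def PiE_iff)
      moreover have "(\<Sum>j<?n. int (v j) * of_bool (l = min j m)) = (\<Sum>j\<in>{l}. int (v j))"
        by (rule sum.mono_neutral_cong_right) (use l in auto)
      ultimately show ?thesis
        using coord[of l] l p by auto
    qed
    moreover have "(\<Sum>j<?n. int (v j) * of_bool (m = min j m)) = (\<Sum>j\<in>{m..<?n}. int (v j))"
      by (rule sum.mono_neutral_cong_right) auto
    then have "c v m = (\<Sum>j\<in>{m..<?n}. int (v j)) mod int p"
      using coord[of m] by simp
    ultimately show ?thesis
      by simp
  qed
  have "compose (discrete_cube ?n) (restrict ?f ?B) (restrict c (discrete_cube ?n)) v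
        [^] vertex_sign ?n v
      = g [^] ((\<Prod>l<m. int (v l)) * ((\<Sum>j\<in>{m..<?n}. int (v j)) mod int p) * vertex_sign ?n v)"
    if v: "v \<in> discrete_cube ?n" for v
  proof -
    have "c v \<in> {..<?i} \<rightarrow>\<^sub>E UNIV"
      using mem[of v] by (auto simp: PiE_iff)
    then have "compose (discrete_cube ?n) (restrict ?f ?B) (restrict c (discrete_cube ?n)) v
        = g [^] (\<Prod>l<?i. c v l)"
      using v mem[of v] by (simp only: compose_def restrict_apply' if_True)
    then show ?thesis
      unfolding prod[OF v] using gc by (simp add: int_pow_pow)
  qed
  then have "(\<Otimes>v\<in>discrete_cube ?n.
        compose (discrete_cube ?n) (restrict ?f ?B) (restrict c (discrete_cube ?n)) v
          [^] vertex_sign ?n v)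
      = (\<Otimes>v\<in>discrete_cube ?n.
          g [^] ((\<Prod>l<m. int (v l)) * ((\<Sum>j\<in>{m..<?n}. int (v j)) mod int p) * vertex_sign ?n v))"
    using gc by (intro finprod_cong') auto
  also have "\<dots> = g [^] (- int p * (-1) ^ ?n)"
    unfolding finprod_int_pow[OF gc finite_discrete_cube] sum_vertex_sign_wrapped[OF p, of m] ..
  finally have alt: "g [^] (- int p * (-1) ^ ?n) \<in> Gs ?n"
    using alternating_product_in_filtration[OF filt cube] by simp
  \<comment> \<open>Raising to the power of the same sign turns the exponent into \<open>p\<close>.\<close>
  have "(g [^] (- int p * (-1) ^ ?n)) [^] (- ((-1) ^ ?n) :: int) \<in> Gs ?n"
    by (rule subgroup_int_pow_closed[OF filtration_subgroup[OF filt] alt])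
  moreover have "(- int p * (-1) ^ ?n) * (- ((-1) ^ ?n)) = int p"
    by (simp add: mult.assoc flip: power_mult_distrib)
  ultimately show ?thesis
    using gc by (simp only: int_pow_pow int_pow_int)
qed

section \<open>Finite cyclic groups\<close>

lemma (in group) subgroup_cyclic_generator:
  assumes "finite (carrier G)" "cyclic_group G" "subgroup H G"
  obtains h where "h \<in> H" "H = generate G {h}"
proof -
  obtain a where a: "a \<in> carrier G" "carrier G = range (\<lambda>n::int. a [^] n)"
    using assms(2) cyclic_group by blast
  interpret H: subgroup H G by fact
  define d where "d = (LEAST d::nat. 0 < d \<and> a [^] d \<in> H)"
  have "0 < order G \<and> a [^] order G \<in> H"
    using assms(1) a by (simp add: order_gt_0_iff_finite pow_order_eq_1)
  then have d: "0 < d \<and> a [^] d \<in> H"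
    unfolding d_def by (rule LeastI)
  have "H \<subseteq> generate G {a [^] d}"
  proof
    fix y assume y: "y \<in> H"
    then obtain n :: int where n: "y = a [^] n"
      using a H.subset by blast
    define r where "r = nat (n mod int d)"
    have r: "int r = n mod int d" "r < d"
      using d by (auto simp: r_def nat_less_iff)
    have "a [^] n \<otimes> inv ((a [^] d) [^] (n div int d)) \<in> H"
      using y n d subgroup_int_pow_closed[OF H.subgroup_axioms] by auto
    also have "a [^] n \<otimes> inv ((a [^] d) [^] (n div int d)) = a [^] (n - int d * (n div int d))"
      using a by (simp add: int_pow_diff int_pow_pow flip: int_pow_int)
    also have "\<dots> = a [^] r"
      using r by (simp add: minus_mult_div_eq_mod flip: int_pow_int)
    finally have "\<not> 0 < r"
      using not_less_Least[OF r(2)[unfolded d_def]] by simp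
    then have "n mod int d = 0"
      using r by simp
    then have "n = int d * (n div int d)"
      using mult_div_mod_eq[of "int d" n] by linarith
    then have "y = (a [^] d) [^] (n div int d)"
      using n a by (metis int_pow_int int_pow_pow)
    then show "y \<in> generate G {a [^] d}"
      using generate_pow[OF nat_pow_closed[OF a(1)], of d] by blast
  qed
  moreover have "generate G {a [^] d} \<subseteq> H"
    using d by (intro generate_subgroup_incl H.subgroup_axioms) auto
  ultimately show thesis
    using that d by blast
qed

lemma (in group) generate_pow_image:
  assumes "h \<in> carrier G"
  shows "(\<lambda>g. g [^] (p::nat)) ` generate G {h} = generate G {h [^] p}"
proof -
  have "(h [^] n) [^] p = (h [^] p) [^] n" for n :: int
    using assms by (simp add: int_pow_pow mult.commute flip: int_pow_int)
  then show ?thesis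
    using assms by (simp add: generate_pow full_SetCompr_eq image_image)
qed

text \<open>If \<open>h\<close> generates \<open>H\<close>, then a power \<open>h\<^sup>n \<in> K\<close> with \<open>n\<close> coprime to \<open>p\<close> would, together with
  \<open>h\<^sup>p \<in> K\<close>, put \<open>h\<close> itself into \<open>K\<close>. So only exponents divisible by \<open>p\<close> occur in \<open>K\<close>. Taking for
  \<open>n\<close> the order of \<open>h\<close> shows that \<open>p\<close> divides it, which gives the index.\<close>

lemma (in group) cyclic_subgroup_between:
  assumes "Factorial_Ring.prime (p::nat)" and fin: "finite (carrier G)" "cyclic_group G"
    and H: "subgroup H G" and K: "subgroup K G"
    and "(\<lambda>g. g [^] p) ` H \<subseteq> K" "K \<subset> H"
  shows "K = (\<lambda>g. g [^] p) ` H" "card H = p * card K"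
proof -
  interpret K: subgroup K G by fact
  obtain h where h: "h \<in> H" "H = generate G {h}"
    using subgroup_cyclic_generator[OF fin H] .
  have hc: "h \<in> carrier G"
    using h H subgroup.mem_carrier by fast
  have img: "(\<lambda>g. g [^] p) ` H = generate G {h [^] p}"
    using h hc generate_pow_image by simp
  have hK: "h \<notin> K"
    using assms(7) h generate_subgroup_incl[OF _ K, of "{h}"] by auto
  have hpK: "h [^] int p \<in> K"
    using assms(6) h by (auto simp: int_pow_int)
  have coprime_hK: False if "coprime (int p) n" "h [^] n \<in> K" for n
  proof -
    obtain u w where "u * int p + w * n = 1"
      using \<open>coprime (int p) n\<close> bezout_int[of "int p" n] by auto
    then have "h = (h [^] int p) [^] u \<otimes> (h [^] n) [^] w"
      using hc by (simp add: int_pow_pow mult.commute flip: int_pow_mult)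
    then show False
      using hK K.m_closed[OF subgroup_int_pow_closed[OF K hpK] subgroup_int_pow_closed[OF K that(2)]]
      by metis
  qed
  have "K \<subseteq> (\<lambda>g. g [^] p) ` H"
  proof
    fix y assume y: "y \<in> K"
    then obtain n :: int where n: "y = h [^] n"
      using assms(7) h hc by (auto simp: generate_pow)
    have "\<not> coprime (int p) n"
      using coprime_hK y n by blast
    then have "int p dvd n"
      using assms(1) by (meson prime_imp_coprime prime_nat_int_transfer)
    then obtain l where "n = int p * l" ..
    then have "y = (h [^] p) [^] l"
      using n hc by (simp add: int_pow_pow flip: int_pow_int)
    then show "y \<in> (\<lambda>g. g [^] p) ` H"
      using img hc by (auto simp: generate_pow)
  qed
  then show K_eq: "K = (\<lambda>g. g [^] p) ` H"
    using assms(6) by auto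
  have "\<not> coprime (int p) (int (ord h))"
    using coprime_hK[of "int (ord h)"] hc K.one_closed by (auto simp: int_pow_int)
  then have dvd: "p dvd ord h"
    using assms(1) by (metis coprime_int_iff prime_imp_coprime)
  have "card K = ord h div p"
    using dvd hc assms(1) by (simp add: K_eq img ord_pow prime_gt_0_nat flip: generate_pow_card)
  then show "card H = p * card K"
    using dvd hc h by (simp flip: generate_pow_card)
qed

lemma (in group) finite_cyclic_iso_integer_mod_group:
  assumes "finite (carrier G)" "cyclic_group G"
  shows "G \<cong> integer_mod_group (order G)"
proof -
  obtain a where a: "a \<in> carrier G" "carrier G = range (\<lambda>n::int. a [^] n)"
    using assms(2) cyclic_group by blast
  have N: "ord a = order G"
    using a generate_pow_card[OF a(1)] generate_pow[OF a(1)] by (simp add: order_def full_SetCompr_eq)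
  have pos: "order G > 0"
    using assms(1) by (simp add: order_gt_0_iff_finite)
  have mod: "a [^] (n mod int (order G)) = a [^] n" for n :: int
    using a N int_pow_eq[OF a(1), of "n mod int (order G)" n] by (simp add: mod_eq_dvd_iff)
  let ?Z = "integer_mod_group (order G)"
  have "(\<lambda>n::int. a [^] n) \<in> iso ?Z G"
  proof (rule isoI)
    show "(\<lambda>n::int. a [^] n) \<in> hom ?Z G"
      using a by (intro homI) (auto simp: mod int_pow_mult)
    show "bij_betw (\<lambda>n::int. a [^] n) (carrier ?Z) (carrier G)"
      unfolding bij_betw_def
    proof
      show "inj_on (\<lambda>n::int. a [^] n) (carrier ?Z)"
      proof (rule inj_onI)
        fix m n :: int
        assume mn: "m \<in> carrier ?Z" "n \<in> carrier ?Z" "a [^] m = a [^] n"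
        then have "int (order G) dvd n - m"
          using int_pow_eq[OF a(1), of m n] N by simp
        then have "n mod int (order G) = m mod int (order G)"
          by (simp add: mod_eq_dvd_iff)
        then show "m = n"
          using mn pos by (simp add: carrier_integer_mod_group)
      qed
      show "(\<lambda>n::int. a [^] n) ` carrier ?Z = carrier G"
      proof
        show "carrier G \<subseteq> (\<lambda>n::int. a [^] n) ` carrier ?Z"
        proof
          fix y assume "y \<in> carrier G"
          then obtain n :: int where "y = a [^] (n mod int (order G))"
            using a mod by auto
          then show "y \<in> (\<lambda>n::int. a [^] n) ` carrier ?Z"
            using pos by (auto simp: carrier_integer_mod_group)
        qed
      qed (use a in auto)
    qed
  qed
  then show ?thesis
    using group.iso_sym[OF group_integer_mod_group] is_isoI by blast
qed

text \<open>Two elements in the same block of \<open>t\<close> consecutive integers are too close, and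
  \<open>{1..k}\<close> is covered by \<open>(k - 1) div t + 1\<close> such blocks.\<close>

lemma card_separated_le:
  assumes sub: "D \<subseteq> {1..k}" and sep: "separated (int t) (int ` D)" and t: "t > 0" and k: "k > 0"
  shows "card D \<le> (k - 1) div t + 1"
proof -
  have "inj_on (\<lambda>i. (i - 1) div t) D"
  proof (rule inj_onI)
    fix a b assume ab: "a \<in> D" "b \<in> D" "(a - 1) div t = (b - 1) div t"
    show "a = b"
    proof (rule ccontr)
      assume "a \<noteq> b"
      then have "\<bar>int a - int b\<bar> \<ge> int t"
        using sep ab unfolding separated_def by auto
      moreover have "a \<ge> 1" "b \<ge> 1"
        using sub ab by auto
      moreover have "a - 1 < (a - 1) div t * t + t" "b - 1 < (a - 1) div t * t + t"
        using dividend_less_div_times[OF t, of "a - 1"] dividend_less_div_times[OF t, of "b - 1"]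
          ab(3) by (simp_all add: add.commute)
      moreover have "(a - 1) div t * t \<le> a - 1" "(a - 1) div t * t \<le> b - 1"
        using div_times_less_eq_dividend[of "b - 1" t] unfolding ab(3)[symmetric] by auto
      ultimately show False
        by linarith
    qed
  qed
  moreover have "(\<lambda>i. (i - 1) div t) ` D \<subseteq> {..(k - 1) div t}"
    using sub by (auto intro!: div_le_mono diff_le_mono)
  ultimately have "card D \<le> card {..(k - 1) div t}"
    using card_inj_on_le by blast
  then show ?thesis by simp
qed

theorem proposition3p9:
  fixes p k :: nat and G :: "'a monoid" and Gs :: "nat \<Rightarrow> 'a set"
  assumes "Factorial_Ring.prime p"
    and "group G" and "finite (carrier G)" and "cyclic_group G"
    and "filtration G Gs" and "filtration_degree G Gs k"
    and "p_homogeneous p (group_nilspace G Gs)"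
  shows "\<exists>d. 0 < d \<and> d \<le> (k - 1) div (p - 1) + 1 \<and> G \<cong> integer_mod_group (p ^ d) \<and>
           (\<exists>\<Delta>. \<Delta> \<subseteq> {1..k} \<and> separated (int p - 1) (int ` \<Delta>) \<and> card \<Delta> = d \<and> k \<in> \<Delta> \<and>
              (\<forall>i\<in>\<Delta>. Gs (i + 1) = (\<lambda>g. g [^]\<^bsub>G\<^esub> p) ` Gs i) \<and>
              (\<forall>i. i \<notin> \<Delta> \<longrightarrow> Gs (i + 1) = Gs i))"
proof -
  interpret comm_group G
    using assms(2,4) by (rule group.cyclic_imp_abelian_group)
  note filt = assms(5)
  have p: "p \<ge> 2"
    using assms(1) by (rule prime_ge_2_nat)
  define D where "D = {i. Gs (i + 1) \<noteq> Gs i}"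
  have bottom: "Gs i = {\<one>\<^bsub>G\<^esub>}" if "i > k" for i
  proof -
    have "Gs i \<subseteq> Gs (Suc k)"
      using that by (intro filtration_antimono[OF filt]) simp
    moreover have "\<one>\<^bsub>G\<^esub> \<in> Gs i"
      using filtration_subgroup[OF filt] by (rule subgroup.one_closed)
    ultimately show ?thesis
      using assms(6) unfolding filtration_degree_def by auto
  qed
  have "0 \<notin> D"
    using filt by (simp add: D_def filtration_def)
  moreover have "i \<notin> D" if "i > k" for i
    using bottom that by (simp add: D_def)
  ultimately have D: "D \<subseteq> {1..k}"
    by (metis One_nat_def Suc_leI atLeastAtMost_iff neq0_conv not_le subsetI)
  have kD: "k \<in> D"
    using assms(6) unfolding D_def filtration_degree_def by auto
  have shift: "(\<lambda>g. g [^]\<^bsub>G\<^esub> p) ` Gs i \<subseteq> Gs (i + p - 1)" if "i \<ge> 1" for i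
    using homogeneous_pow_in_filtration[OF filt assms(7) p, of _ "i - 1"] that by auto
  have jump: "Gs (i + 1) = (\<lambda>g. g [^]\<^bsub>G\<^esub> p) ` Gs i" "card (Gs i) = p * card (Gs (i + 1))"
    if "i \<in> D" for i
  proof -
    have "i \<ge> 1"
      using D that by auto
    have "Gs (i + p - 1) \<subseteq> Gs (i + 1)"
      by (rule filtration_antimono[OF filt]) (use p in simp)
    with shift[OF \<open>i \<ge> 1\<close>] have "(\<lambda>g. g [^]\<^bsub>G\<^esub> p) ` Gs i \<subseteq> Gs (i + 1)"
      by (rule subset_trans)
    moreover have "Gs (i + 1) \<subset> Gs i"
      using that filtration_antimono[OF filt, of i "i + 1"] by (auto simp: D_def)
    ultimately show "Gs (i + 1) = (\<lambda>g. g [^]\<^bsub>G\<^esub> p) ` Gs i" "card (Gs i) = p * card (Gs (i + 1))"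
      using cyclic_subgroup_between[OF assms(1,3,4) filtration_subgroup[OF filt] filtration_subgroup[OF filt]]
      by blast+
  qed
  \<comment> \<open>After a jump at \<open>i\<close> the subgroups \<open>Gs (i + 1)\<close>, ..., \<open>Gs (i + p - 1)\<close> coincide.\<close>
  have gap: "j \<ge> i + (p - 1)" if "i \<in> D" "j \<in> D" "i < j" for i j
  proof (rule ccontr)
    assume "\<not> j \<ge> i + (p - 1)"
    then have "j + 1 \<le> i + p - 1"
      using p by linarith
    have "i \<ge> 1"
      using D that by auto
    have "Gs (i + 1) \<subseteq> Gs (i + p - 1)"
      using jump(1)[OF that(1)] shift[OF \<open>i \<ge> 1\<close>] by simp
    also have "\<dots> \<subseteq> Gs (j + 1)"
      by (rule filtration_antimono[OF filt]) fact
    finally have "Gs j \<subseteq> Gs (j + 1)"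
      using filtration_antimono[OF filt, of "i + 1" j] that by auto
    moreover have "Gs (j + 1) \<subseteq> Gs j"
      by (rule filtration_antimono[OF filt]) simp
    ultimately show False
      using that by (auto simp: D_def)
  qed
  have sep: "separated (int p - 1) (int ` D)"
    unfolding separated_def
  proof (intro ballI impI)
    fix a b assume "a \<in> int ` D" "b \<in> int ` D" "a \<noteq> b"
    then obtain i j where "i \<in> D" "j \<in> D" "a = int i" "b = int j" "i \<noteq> j"
      by auto
    then show "\<bar>a - b\<bar> \<ge> int p - 1"
      using gap[of i j] gap[of j i] by linarith
  qed
  \<comment> \<open>For \<open>i = k + 1\<close> this counts all the jumps and computes the order of \<open>G\<close>.\<close>
  have "card (Gs i) * p ^ card (D \<inter> {..<i}) = card (carrier G)" for i
  proof (induction i)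
    case 0
    then show ?case using filt by (simp add: filtration_def)
  next
    case (Suc i)
    show ?case
    proof (cases "i \<in> D")
      case True
      then have "D \<inter> {..<Suc i} = insert i (D \<inter> {..<i})"
        by (auto simp: less_Suc_eq)
      then show ?thesis
        using Suc jump(2)[OF True] by (simp add: mult_ac)
    next
      case False
      then have "D \<inter> {..<Suc i} = D \<inter> {..<i}"
        by (auto simp: less_Suc_eq)
      then show ?thesis
        using Suc False by (simp add: D_def)
    qed
  qed
  from this[of "Suc k"] have "p ^ card D = order G"
    using D bottom[of "Suc k"] by (simp add: order_def Int_absorb2 subset_iff less_Suc_eq_le)
  then have iso: "G \<cong> integer_mod_group (p ^ card D)"
    using finite_cyclic_iso_integer_mod_group[OF assms(3,4)] by simp
  have "finite D"
    using D finite_subset by blast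
  then have pos: "0 < card D"
    using kD by (auto simp: card_gt_0_iff)
  have "card D \<le> (k - 1) div (p - 1) + 1"
    using card_separated_le[OF D, of "p - 1"] sep p kD D by (auto simp: of_nat_diff)
  then show ?thesis
    using D sep kD jump(1) iso pos
    by (intro exI[of _ "card D"] conjI exI[of _ D]) (auto simp: D_def)
qed

end
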